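(* Let $f(z)=b(z)\prod_{i=0}^{\lfloor d/2\rfloor-1}(z^2+z+c_i)$ be a $CL$-polynomial of degree $d$, where (without loss of generality) the $c_i$ are ordered by size, $c_0\le c_1\le\cdots\le c_{\lfloor d/2\rfloor-1}$. Then $f$ satisfies $(\diamondsuit)$ if the $c_i$ satisfy $$c_i \leq \begin{cases}2i+2, & d\text{ is odd}, \\ 2i+1, & d\text{ is even}.\end{cases}$$
   Context: A $CL$-polynomial of degree $d$ is a polynomial of the form $f(z)=b(z)\prod_{i=0}^{\lfloor d/2\rfloor-1}(z^2+z+c_i)$, where the $c_i$ are real numbers $\geq\frac14$ and, for a non-zero constant $a$, $b(z)=a$ if $d$ is even and $b(z)=a(2z+1)$ if $d$ is odd. For a polynomial $f$ of degree $d$, the $h^*$-polynomial is the polynomial $h^*(t)=\sum_{i=0}^d h^*_i t^i$ with $\sum_{k\ge 0} f(k)t^k=\frac{h^*(t)}{(1-t)^{d+1}}$; equivalently $f(z)=\sum_{i=0}^d h_i^*\binom{z+d-i}{d}$. Property $(\diamondsuit)$ means that the coefficients of the $h^*$-polynomial of $f$ are palindromic (that is, $h^*_i=h^*_{d-i}$ for all $0\le i\le d$) and non-negative.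
   Formalization: The constant a is assumed positive rather than merely non-zero, since for a < 0 the non-negativity of the h*-coefficients fails (for example d = 0, f = -1 has h* = -1). *)

theory Defs
  imports "HOL-Computational_Algebra.Computational_Algebra"
begin

text \<open>
  The function \<open>c\<close> is only relevant on the indices \<open>i < d div 2\<close>.
\<close>
definition CL_form :: "nat \<Rightarrow> real \<Rightarrow> (nat \<Rightarrow> real) \<Rightarrow> real poly" where
  "CL_form d a c =
     (if even d then [:a:] else smult a [:1, 2:]) * (\<Prod>i<d div 2. [:c i, 1, 1:])"

definition is_CL_polynomial :: "nat \<Rightarrow> real \<Rightarrow> (nat \<Rightarrow> real) \<Rightarrow> real poly \<Rightarrow> bool" where
  "is_CL_polynomial d a c f \<longleftrightarrow>
     a \<noteq> 0 \<and> (\<forall>i<d div 2. 1/4 \<le> c i) \<and> f = CL_form d a c"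

lemma degree_CL_form:
  assumes "a \<noteq> 0"
  shows "degree (CL_form d a c) = d"
proof -
  have "degree (\<Prod>i<d div 2. [:c i, 1, 1:]) = (\<Sum>i<d div 2. 2)"
    by (subst degree_prod_eq_sum_degree) auto
  moreover have "(\<Prod>i<d div 2. [:c i, 1, 1:]) \<noteq> 0"
    by auto
  ultimately show ?thesis
    using assms by (auto simp: CL_form_def degree_mult_eq elim!: oddE)
qed

text \<open>
  The identity defining the numerator is one of formal power series; it determines the
  numerator uniquely, so the description is well defined.
\<close>
definition hstar_poly :: "real poly \<Rightarrow> real poly" where
  "hstar_poly f = (THE h.
     Abs_fps (\<lambda>k. poly f (of_nat k)) = fps_of_poly h / (1 - fps_X) ^ (degree f + 1))"

lemma hstar_numerator_exists:
  fixes p :: "real poly"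
  assumes "degree p \<le> d"
  shows "\<exists>h. degree h \<le> d \<and>
    Abs_fps (\<lambda>k. poly p (of_nat k)) * (1 - fps_X) ^ (d + 1) = fps_of_poly h"
  using assms
proof (induction d arbitrary: p)
  case 0
  then obtain b where p: "p = [:b:]"
    by (metis le_zero_eq degree_eq_zeroE)
  have "Abs_fps (\<lambda>k. poly p (of_nat k)) * (1 - fps_X) = fps_of_poly [:b:]"
    by (rule fps_ext) (auto simp: p algebra_simps fps_of_poly_const)
  then show ?case
    by (intro exI[of _ "[:b:]"]) simp
next
  case (Suc d)
  define q where "q = p - pcompose p [:-1, 1:]"
  have "degree q \<le> d"
  proof (rule degree_le, intro allI impI)
    fix i assume i: "d < i"
    have dc: "degree (pcompose p [:-1, 1:]) = degree p"
      by (simp add: degree_pcompose)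
    show "coeff q i = 0"
    proof (cases "i = degree p")
      case True
      have "lead_coeff (pcompose p [:-1, 1:]) = lead_coeff p"
        by (subst lead_coeff_comp) auto
      then show ?thesis
        using True dc by (simp add: q_def)
    next
      case False
      then have "degree p < i"
        using i Suc.prems by linarith
      then show ?thesis
        using dc by (simp add: q_def coeff_eq_0)
    qed
  qed
  then obtain h where h: "degree h \<le> d"
    "Abs_fps (\<lambda>k. poly q (of_nat k)) * (1 - fps_X) ^ (d + 1) = fps_of_poly h"
    using Suc.IH by blast
  define h' where "h' = h + smult (poly p (-1)) ([:1, -1:] ^ (d + 1))"
  have step: "Abs_fps (\<lambda>k. poly p (of_nat k)) * (1 - fps_X) =
      Abs_fps (\<lambda>k. poly q (of_nat k)) + fps_const (poly p (-1))"
  proof (rule fps_ext)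
    fix n
    show "(Abs_fps (\<lambda>k. poly p (of_nat k)) * (1 - fps_X)) $ n =
        (Abs_fps (\<lambda>k. poly q (of_nat k)) + fps_const (poly p (-1))) $ n"
      by (cases n) (auto simp: algebra_simps q_def poly_pcompose)
  qed
  have X: "fps_of_poly [:1, -1:] = (1 - fps_X :: real fps)"
    by (simp add: fps_of_poly_pCons)
  have "Abs_fps (\<lambda>k. poly p (of_nat k)) * (1 - fps_X) ^ (Suc d + 1) =
      (Abs_fps (\<lambda>k. poly p (of_nat k)) * (1 - fps_X)) * (1 - fps_X) ^ (d + 1)"
    by (simp add: mult_ac)
  also have "\<dots> = fps_of_poly h + fps_const (poly p (-1)) * (1 - fps_X) ^ (d + 1)"
    unfolding step distrib_right h(2) ..
  also have "\<dots> = fps_of_poly h'"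
    unfolding h'_def fps_of_poly_add fps_of_poly_smult fps_of_poly_power X ..
  finally have "Abs_fps (\<lambda>k. poly p (of_nat k)) * (1 - fps_X) ^ (Suc d + 1) = fps_of_poly h'" .
  moreover have "degree h' \<le> Suc d"
    unfolding h'_def using h(1)
    by (intro degree_add_le order.trans[OF degree_smult_le] order.trans[OF degree_power_le]) auto
  ultimately show ?case
    by blast
qed

lemma hstar_equation_iff:
  "F = fps_of_poly h / (1 - fps_X) ^ n \<longleftrightarrow> F * (1 - fps_X) ^ n = fps_of_poly (h :: real poly)"
proof -
  have u: "((1 - fps_X) ^ n :: real fps) $ 0 \<noteq> 0"
    by (simp add: fps_nth_power_0)
  then have "(1 - fps_X) ^ n * inverse ((1 - fps_X) ^ n :: real fps) = 1"
    by (simp add: inverse_mult_eq_1')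
  then show ?thesis
    unfolding fps_divide_unit[OF u]
    by (metis (no_types, lifting) mult.assoc mult.commute mult.right_neutral)
qed

lemma hstar_poly:
  "Abs_fps (\<lambda>k. poly f (of_nat k)) = fps_of_poly (hstar_poly f) / (1 - fps_X) ^ (degree f + 1)"
  "degree (hstar_poly f) \<le> degree f"
proof -
  obtain h where h: "degree h \<le> degree f"
    "Abs_fps (\<lambda>k. poly f (of_nat k)) * (1 - fps_X) ^ (degree f + 1) = fps_of_poly h"
    using hstar_numerator_exists[of f "degree f"] by blast
  have "hstar_poly f = h"
    unfolding hstar_poly_def hstar_equation_iff h(2) by (rule the_equality) auto
  then show
    "Abs_fps (\<lambda>k. poly f (of_nat k)) = fps_of_poly (hstar_poly f) / (1 - fps_X) ^ (degree f + 1)"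
    "degree (hstar_poly f) \<le> degree f"
    using h by (simp_all only: hstar_equation_iff)
qed

definition diamond :: "real poly \<Rightarrow> bool" where
  "diamond f \<longleftrightarrow>
     (\<forall>i\<le>degree f. coeff (hstar_poly f) i = coeff (hstar_poly f) (degree f - i)) \<and>
     (\<forall>i\<le>degree f. 0 \<le> coeff (hstar_poly f) i)"

end

theory Submission
  imports Defs
begin

text \<open>
  Multiplying a polynomial of degree \<open>d\<close> by \<open>z\<^sup>2 + z + c\<close> turns its numerator \<open>h\<close> into
  \<open>h' n = (n (n + 1) + c) h n + 2 (n (d + 2 - n) - c) h (n - 1)
    + ((d + 2 - n) (d + 3 - n) + c) h (n - 2)\<close>.
  This recurrence is symmetric under \<open>n \<mapsto> d + 2 - n\<close>, and for \<open>c \<ge> 0\<close> only the middle coefficient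
  can be negative; it is non-negative for \<open>1 \<le> n \<le> d + 1\<close> as soon as \<open>c \<le> d + 1\<close>. Multiplying in the factors one at a time,
  starting from \<open>h = a\<close> or \<open>h = a (1 + t)\<close>, the bound on \<open>c i\<close> is exactly this condition.
\<close>

text \<open>
  Numerators are stored as sequences on the integers, so that the recurrence and the reflection
  \<open>i \<mapsto> d - i\<close> need no boundary cases.
\<close>
definition numerator_seq :: "nat \<Rightarrow> (nat \<Rightarrow> real) \<Rightarrow> (int \<Rightarrow> real) \<Rightarrow> bool" where
  "numerator_seq m u h \<longleftrightarrow>
     (\<forall>i<0. h i = 0) \<and> Abs_fps u * (1 - fps_X) ^ m = Abs_fps (\<lambda>n. h (int n))"

lemma numerator_seq_add:
  assumes "numerator_seq m u h" "numerator_seq m v k"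
  shows "numerator_seq m (\<lambda>n. u n + v n) (\<lambda>i. h i + k i)"
proof -
  have "Abs_fps (\<lambda>n. p n + q n) = Abs_fps p + Abs_fps q" for p q :: "nat \<Rightarrow> real"
    by (simp add: fps_eq_iff)
  then show ?thesis
    using assms by (simp add: numerator_seq_def distrib_right)
qed

lemma numerator_seq_smult:
  assumes "numerator_seq m u h"
  shows "numerator_seq m (\<lambda>n. r * u n) (\<lambda>i. r * h i)"
proof -
  have "Abs_fps (\<lambda>n. r * p n) = fps_const r * Abs_fps p" for p :: "nat \<Rightarrow> real"
    by (simp add: fps_eq_iff)
  then show ?thesis
    using assms by (simp add: numerator_seq_def mult.assoc)
qed

text \<open>Brings numerators over different powers of \<open>1 - fps_X\<close> to a common power,
  so that they can be added.\<close>

lemma numerator_seq_Suc: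
  assumes "numerator_seq m u h"
  shows "numerator_seq (Suc m) u (\<lambda>i. h i - h (i - 1))"
proof -
  have "Abs_fps u * (1 - fps_X) ^ Suc m = Abs_fps (\<lambda>n. h (int n)) * (1 - fps_X)"
    using assms by (simp add: numerator_seq_def mult_ac)
  also have "\<dots> = Abs_fps (\<lambda>n. h (int n) - h (int n - 1))"
  proof (rule fps_ext)
    fix n show "(Abs_fps (\<lambda>n. h (int n)) * (1 - fps_X)) $ n
      = Abs_fps (\<lambda>n. h (int n) - h (int n - 1)) $ n"
      using assms by (cases n) (auto simp: numerator_seq_def algebra_simps)
  qed
  finally show ?thesis
    using assms by (simp add: numerator_seq_def)
qed

text \<open>Multiplication by the index is the operator \<open>X * d/dX\<close> on series.
  Differentiating \<open>F * (1 - X) ^ m = H\<close> gives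
  \<open>X * F' * (1 - X) ^ (m + 1) = (1 - X) * X * H' + m * X * H\<close>.\<close>

lemma numerator_seq_mult_index:
  assumes "numerator_seq m u h"
  shows "numerator_seq (Suc m) (\<lambda>n. real n * u n)
    (\<lambda>i. of_int i * h i + (of_nat m + 1 - of_int i) * h (i - 1))"
proof (cases m)
  \<comment> \<open>Separate because the derivative of \<open>(1 - X) ^ m\<close> involves the
    exponent \<open>m - 1\<close>.\<close>
  case 0
  have "u n = h (int n)" for n
    using assms 0 by (simp add: numerator_seq_def fps_eq_iff)
  then have "numerator_seq 0 (\<lambda>n. real n * u n) (\<lambda>i. of_int i * h i)"
    using assms by (simp add: numerator_seq_def)
  from numerator_seq_Suc[OF this] show ?thesis
    using 0 by (simp add: algebra_simps)
next
  case (Suc l)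
  define F H where "F = Abs_fps u" and "H = Abs_fps (\<lambda>n. h (int n))"
  have H: "F * (1 - fps_X) ^ Suc l = H"
    using assms Suc by (simp add: numerator_seq_def F_def H_def)
  have theta: "Abs_fps (\<lambda>n. real n * v n) = fps_X * fps_deriv (Abs_fps v)" for v
  proof (rule fps_ext)
    fix n show "Abs_fps (\<lambda>n. real n * v n) $ n = (fps_X * fps_deriv (Abs_fps v)) $ n"
      by (cases n) auto
  qed
  define r where "r = fps_const (real m)"
  have D: "fps_deriv H = fps_deriv F * (1 - fps_X) ^ Suc l - r * F * (1 - fps_X) ^ l"
    unfolding H[symmetric] fps_deriv_mult fps_deriv_power Suc[symmetric] r_def[symmetric]
    by (simp add: Suc algebra_simps)
  have "fps_X * fps_deriv F * (1 - fps_X) ^ Suc m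
      = (1 - fps_X) * (fps_X * fps_deriv H) + r * (fps_X * H)"
    unfolding D unfolding H[symmetric] by (simp add: Suc algebra_simps)
  also have "\<dots> = Abs_fps (\<lambda>n. of_int (int n) * h (int n)
      + (of_nat m + 1 - of_int (int n)) * h (int n - 1))"
  proof (rule fps_ext)
    fix n
    show "((1 - fps_X) * (fps_X * fps_deriv H) + r * (fps_X * H)) $ n
      = Abs_fps (\<lambda>n. of_int (int n) * h (int n)
          + (of_nat m + 1 - of_int (int n)) * h (int n - 1)) $ n"
      using assms
      by (cases n)
        (auto simp: H_def r_def theta[symmetric] left_diff_distrib numerator_seq_def algebra_simps)
  qed
  finally show ?thesis
    using assms by (simp add: numerator_seq_def theta F_def)
qed

text \<open>The values \<open>n * (n * u n)\<close>, \<open>n * u n\<close> and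
  \<open>c * u n\<close> are each put over the exponent \<open>d + 3\<close> and added.\<close>

lemma numerator_seq_mult_quadratic:
  assumes "numerator_seq (Suc d) u h"
  shows "numerator_seq (d + 3) (\<lambda>n. (real n ^ 2 + real n + c) * u n)
    (\<lambda>i. (of_int (i * (i + 1)) + c) * h i + 2 * (of_int (i * (int d + 2 - i)) - c) * h (i - 1)
        + (of_int ((int d + 2 - i) * (int d + 3 - i)) + c) * h (i - 2))"
proof -
  have three: "d + 3 = Suc (Suc (Suc d))"
    by simp
  note 1 = numerator_seq_mult_index[OF assms]
  note 2 = numerator_seq_add[OF numerator_seq_add[OF
      numerator_seq_mult_index[OF 1] numerator_seq_Suc[OF 1]]
      numerator_seq_smult[OF numerator_seq_Suc[OF numerator_seq_Suc[OF assms]], of c]]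
  show ?thesis
    using 2 unfolding three
    \<comment> \<open>What remains is pointwise equality of the values and of the
      numerators.\<close>
    by (rule back_subst[of "\<lambda>x. x"])
      (intro arg_cong2[of _ _ _ _ "numerator_seq _"] ext; simp add: algebra_simps power2_eq_square)
qed

text \<open>Reflection over all integers, with \<open>h\<close> zero on the negatives, makes
  \<open>h\<close> vanish above \<open>d\<close>; this encodes the degree bound. Keeping
  \<open>d\<close> as a parameter spares degree computations in the induction.\<close>

definition palindromic_numerator :: "nat \<Rightarrow> real poly \<Rightarrow> bool" where
  "palindromic_numerator d f \<longleftrightarrow> (\<exists>h. numerator_seq (Suc d) (\<lambda>n. poly f (real n)) h \<and>
     (\<forall>i. h i = h (int d - i)) \<and> (\<forall>i. 0 \<le> h i))"

lemma palindromic_numerator_imp_diamond: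
  assumes "palindromic_numerator (degree f) f"
  shows "diamond f"
proof -
  obtain h where h: "numerator_seq (Suc (degree f)) (\<lambda>n. poly f (real n)) h"
    "\<And>i. h i = h (int (degree f) - i)" "\<And>i. 0 \<le> h i"
    using assms unfolding palindromic_numerator_def by blast
  have "fps_of_poly (hstar_poly f) = Abs_fps (\<lambda>n. h (int n))"
    using hstar_poly(1)[of f] h(1) unfolding hstar_equation_iff numerator_seq_def by simp
  then have "coeff (hstar_poly f) n = h (int n)" for n
    by (simp add: fps_eq_iff)
  then show ?thesis
    using h(2,3) by (simp add: diamond_def of_nat_diff)
qed

lemma palindromic_numerator_mult_quadratic:
  assumes "palindromic_numerator d f" "0 \<le> c" "c \<le> real d + 1"
  shows "palindromic_numerator (d + 2) (f * [:c, 1, 1:])"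
proof -
  obtain h where h: "numerator_seq (Suc d) (\<lambda>n. poly f (real n)) h"
    and sym: "\<And>i. h i = h (int d - i)" and pos: "\<And>i. 0 \<le> h i"
    using assms unfolding palindromic_numerator_def by blast
  define h' where "h' = (\<lambda>i. (of_int (i * (i + 1)) + c) * h i
        + 2 * (of_int (i * (int d + 2 - i)) - c) * h (i - 1)
        + (of_int ((int d + 2 - i) * (int d + 3 - i)) + c) * h (i - 2))"
  have "numerator_seq (Suc (d + 2)) (\<lambda>n. poly (f * [:c, 1, 1:]) (real n)) h'"
    using numerator_seq_mult_quadratic[OF h, of c]
    by (simp add: h'_def algebra_simps power2_eq_square eval_nat_numeral)
  \<comment> \<open>The reflection swaps the two outer terms and fixes the middle one.\<close>
  moreover have "h' i = h' (int (d + 2) - i)" for i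
    using sym[of i] sym[of "i - 1"] sym[of "i - 2"]
    by (simp add: h'_def algebra_simps)
  moreover have "0 \<le> h' i" for i
  proof -
    \<comment> \<open>Both outer coefficients are such a product plus \<open>c\<close>; integrality
      of \<open>k\<close> is essential.\<close>
    have consecutive: "0 \<le> k * (k + 1)" for k :: int
      by (cases "0 \<le> k") (auto intro: mult_nonpos_nonpos)
    have "0 \<le> 2 * (of_int (i * (int d + 2 - i)) - c) * h (i - 1)"
    proof (cases "1 \<le> i \<and> i \<le> int d + 1")
      case True
      \<comment> \<open>This product is exactly \<open>i * (d + 2 - i) - (d + 1)\<close>.\<close>
      then have "0 \<le> (i - 1) * (int d + 1 - i)"
        by simp
      then have "int d + 1 \<le> i * (int d + 2 - i)"
        by (simp add: algebra_simps)
      then have "real_of_int (int d + 1) \<le> of_int (i * (int d + 2 - i))"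
        by (simp only: of_int_le_iff)
      then show ?thesis
        using assms(3) pos by simp
    next
      case False
      \<comment> \<open>Here \<open>i - 1\<close> lies outside \<open>0..d\<close>, where
        \<open>h\<close> vanishes.\<close>
      then have "h (i - 1) = 0"
        using h sym[of "i - 1"] by (auto simp: numerator_seq_def not_le)
      then show ?thesis
        by simp
    qed
    moreover have "0 \<le> (int d + 2 - i) * (int d + 3 - i)"
      using consecutive[of "int d + 2 - i"] by (simp add: algebra_simps)
    ultimately show ?thesis
      unfolding h'_def using consecutive[of i] pos assms(2)
      by (intro add_nonneg_nonneg mult_nonneg_nonneg[of "_ + c"]) (simp_all only: of_int_0_le_iff)
  qed
  ultimately show ?thesis
    unfolding palindromic_numerator_def by blast
qed

lemma palindromic_numerator_const:
  assumes "0 \<le> a"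
  shows "palindromic_numerator 0 [:a:]"
proof -
  have "Abs_fps (\<lambda>n. a) * (1 - fps_X) = Abs_fps (\<lambda>n. if int n = 0 then a else 0)"
    by (rule fps_ext) (auto simp: algebra_simps)
  then show ?thesis
    unfolding palindromic_numerator_def numerator_seq_def using assms
    by (intro exI[of _ "\<lambda>i. if i = 0 then a else 0"]) auto
qed

text \<open>The numerator is \<open>a * (1 + t)\<close>, assembled from that of the constant
  sequence \<open>a\<close>.\<close>

lemma palindromic_numerator_linear:
  assumes "0 \<le> a"
  shows "palindromic_numerator 1 (smult a [:1, 2:])"
proof -
  have "numerator_seq 1 (\<lambda>n. a) (\<lambda>i. if i = 0 then a else 0)"
    unfolding numerator_seq_def by (auto intro!: fps_ext simp: algebra_simps)
  note 1 = numerator_seq_add[OF numerator_seq_Suc[OF this]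
      numerator_seq_smult[OF numerator_seq_mult_index[OF this], of 2]]
  have "numerator_seq (Suc 1) (\<lambda>n. poly (smult a [:1, 2:]) (real n))
      (\<lambda>i. if i = 0 \<or> i = 1 then a else 0)"
    using 1
    by (rule back_subst[of "\<lambda>x. x"])
      (intro arg_cong2[of _ _ _ _ "numerator_seq _"] ext; auto simp: algebra_simps)
  then show ?thesis
    unfolding palindromic_numerator_def using assms
    by (intro exI[of _ "\<lambda>i. if i = 0 \<or> i = 1 then a else 0"]) auto
qed

text \<open>When factor \<open>i\<close> is multiplied in, the degree reached is
  \<open>2 * i + e\<close>, so the bound on \<open>c i\<close> is this degree plus one.\<close>

lemma palindromic_numerator_prod:
  assumes "palindromic_numerator e f" "\<forall>i<n. 0 \<le> c i \<and> c i \<le> 2 * real i + real e + 1"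
  shows "palindromic_numerator (2 * n + e) (f * (\<Prod>i<n. [:c i, 1, 1:]))"
  using assms(2)
proof (induction n)
  case 0
  then show ?case
    using assms(1) by simp
next
  case (Suc n)
  then have "palindromic_numerator (2 * n + e + 2) (f * (\<Prod>i<n. [:c i, 1, 1:]) * [:c n, 1, 1:])"
    by (intro palindromic_numerator_mult_quadratic) auto
  then show ?case
    by (simp add: mult_ac)
qed

theorem proposition4p1:
  fixes d :: nat and a :: real and c :: "nat \<Rightarrow> real" and f :: "real poly"
  assumes "is_CL_polynomial d a c f"
    and "0 < a"
    and "\<forall>i j. i \<le> j \<and> j < d div 2 \<longrightarrow> c i \<le> c j"
    and "\<forall>i<d div 2. c i \<le> (if odd d then 2 * real i + 2 else 2 * real i + 1)"
  shows "diamond f"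
proof -
  have f: "f = CL_form d a c"
    using assms(1) by (simp add: is_CL_polynomial_def)
  \<comment> \<open>With \<open>e\<close> the degree of \<open>b\<close>, both parity cases of the
    bound read \<open>2 * i + e + 1\<close>.\<close>
  define e b where "e = d mod 2" and "b = (if even d then [:a:] else smult a [:1, 2:])"
  \<comment> \<open>The sign of \<open>a\<close> matters here: numerators scale with
    \<open>a\<close>, so a negative \<open>a\<close> would break non-negativity.\<close>
  have "palindromic_numerator e b"
    using assms(2) palindromic_numerator_const[of a] palindromic_numerator_linear[of a]
    by (auto simp: e_def b_def odd_iff_mod_2_eq_one)
  moreover have "\<forall>i<d div 2. 0 \<le> c i \<and> c i \<le> 2 * real i + real e + 1"
  proof (intro allI impI)
    fix i assume i: "i < d div 2"
    then have "1 / 4 \<le> c i" "c i \<le> (if odd d then 2 * real i + 2 else 2 * real i + 1)"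
      using assms(1,4) by (auto simp: is_CL_polynomial_def)
    then show "0 \<le> c i \<and> c i \<le> 2 * real i + real e + 1"
      by (cases "odd d") (simp_all add: e_def odd_iff_mod_2_eq_one)
  qed
  ultimately have "palindromic_numerator (2 * (d div 2) + e) (b * (\<Prod>i<d div 2. [:c i, 1, 1:]))"
    by (rule palindromic_numerator_prod)
  then have "palindromic_numerator (degree f) f"
    using assms(2) degree_CL_form[of a d c] by (simp add: f e_def b_def flip: CL_form_def)
  then show ?thesis
    by (rule palindromic_numerator_imp_diamond)
qed

end
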